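(* Let $X,Y$ be nonempty sets and $E,K$ sets of parameters. Let $(X,\tau)$ be a fuzzy soft topological space with parameter set $E$ and $(Y,\sigma)$ a fuzzy soft topological space with parameter set $K$. Let $(\varphi,\psi):(X,\tau)\to(Y,\sigma)$, with $\varphi:X\to Y$ and $\psi:E\to K$, be a fuzzy soft mapping that is fuzzy soft continuous and surjective. If $(X,\tau)$ is compact, then $(Y,\sigma)$ is compact.
   Context: Let $I=[0,1]$ and let $I^X$ be the set of all fuzzy sets on $X$, i.e. functions $X\to[0,1]$, ordered pointwise; $0_X$ and $1_X$ are the constant functions $0$ and $1$. A fuzzy soft set over $X$ with parameter set $E$ is a mapping $(f,A):E\to I^X$, where $A\subseteq E$ is the set of parameters $e$ with $(f,A)(e)\neq 0_X$ (so $(f,A)(e)=0_X$ for $e\notin A$); thus $A$ is determined by the mapping. $FS(X,E)$ is the family of all fuzzy soft sets over $X$. Inclusion $(f,A)\subseteq(g,B)$ means $(f,A)(e)\le (g,B)(e)$ for every $e\in E$. Unions and intersections are taken pointwise: for each $e\in E$ and $x\in X$, the supremum, respectively infimum, of the values. The null fuzzy soft set $\tilde 0_E$ takes the value $0_X$ at every $e\in E$; the universal fuzzy soft set $\tilde 1_E$ takes the value $1_X$ at every $e\in E$. A fuzzy soft topological space with parameter set $E$ is a pair $(X,\tau)$ where $\tau\subseteq FS(X,E)$ contains $\tilde 0_E$ and $\tilde 1_E$, is closed under intersections of two members, and is closed under arbitrary unions. Members of $\tau$ are called fuzzy soft open. A fuzzy soft mapping $(\varphi,\psi):FS(X,E)\to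 FS(Y,K)$ is a pair of functions $\varphi:X\to Y$, $\psi:E\to K$; it is surjective (onto) if both $\varphi$ and $\psi$ are surjective. The inverse image of $(g,B)\in FS(Y,K)$ is the fuzzy soft set $(\varphi,\psi)^{-1}((g,B))\in FS(X,E)$ given by $(\varphi,\psi)^{-1}((g,B))(e)(x)=(g,B)(\psi(e))(\varphi(x))$ for $e\in E$, $x\in X$. The mapping $(\varphi,\psi):(X,\tau)\to(Y,\sigma)$ is fuzzy soft continuous if $(\varphi,\psi)^{-1}((g,B))\in\tau$ for all $(g,B)\in\sigma$. A fuzzy soft open cover of $\tilde 1_E$ is a family $\Psi\subseteq\tau$ such that $\tilde 1_E$ is included in the union of all members of $\Psi$; a subcover is a subfamily of $\Psi$ which is also a cover of $\tilde 1_E$. The space $(X,\tau)$ is compact (fuzzy soft compact) if each fuzzy soft open cover of $\tilde 1_E$ has a finite subcover; likewise for $(Y,\sigma)$ with $\tilde 1_K$. *)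

theory Defs
  imports Complex_Main "HOL-Library.FuncSet"
begin

text \<open>
  The sets \<open>X\<close> and \<open>E\<close> are explicit carriers, so that an empty parameter set is allowed. Functions
  on them are extensional, so that HOL equality of fuzzy (soft) sets is equality on the carriers.
\<close>

definition fuzzy_sets :: "'x set \<Rightarrow> ('x \<Rightarrow> real) set" where
  "fuzzy_sets X = (X \<rightarrow>\<^sub>E {0..1})"

text \<open>
  A fuzzy soft set \<open>(f, A)\<close> is represented by the mapping alone, since \<open>A\<close> is determined by it as
  the set of parameters at which the mapping is not the constant 0.
\<close>

definition fuzzy_soft_sets :: "'x set \<Rightarrow> 'e set \<Rightarrow> ('e \<Rightarrow> 'x \<Rightarrow> real) set" where
  "fuzzy_soft_sets X E = (E \<rightarrow>\<^sub>E fuzzy_sets X)"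

definition fs_subset :: "'x set \<Rightarrow> 'e set \<Rightarrow> ('e \<Rightarrow> 'x \<Rightarrow> real) \<Rightarrow> ('e \<Rightarrow> 'x \<Rightarrow> real) \<Rightarrow> bool" where
  "fs_subset X E f g \<longleftrightarrow> (\<forall>e\<in>E. \<forall>x\<in>X. f e x \<le> g e x)"

definition fs_null :: "'x set \<Rightarrow> 'e set \<Rightarrow> 'e \<Rightarrow> 'x \<Rightarrow> real" where
  "fs_null X E = (\<lambda>e\<in>E. \<lambda>x\<in>X. 0)"

definition fs_universal :: "'x set \<Rightarrow> 'e set \<Rightarrow> 'e \<Rightarrow> 'x \<Rightarrow> real" where
  "fs_universal X E = (\<lambda>e\<in>E. \<lambda>x\<in>X. 1)"

definition fs_inter ::
  "'x set \<Rightarrow> 'e set \<Rightarrow> ('e \<Rightarrow> 'x \<Rightarrow> real) \<Rightarrow> ('e \<Rightarrow> 'x \<Rightarrow> real) \<Rightarrow> 'e \<Rightarrow> 'x \<Rightarrow> real" where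
  "fs_inter X E f g = (\<lambda>e\<in>E. \<lambda>x\<in>X. inf (f e x) (g e x))"

text \<open>
  The supremum is taken in the lattice \<open>[0,1]\<close>. Inserting 0 changes nothing for a nonempty
  family, and gives the correct value 0 for the empty one, where \<open>Sup\<close> on the reals is unspecified.
\<close>

definition fs_Union :: "'x set \<Rightarrow> 'e set \<Rightarrow> ('e \<Rightarrow> 'x \<Rightarrow> real) set \<Rightarrow> 'e \<Rightarrow> 'x \<Rightarrow> real" where
  "fs_Union X E \<Psi> = (\<lambda>e\<in>E. \<lambda>x\<in>X. Sup (insert 0 ((\<lambda>f. f e x) ` \<Psi>)))"

definition fuzzy_soft_topology :: "'x set \<Rightarrow> 'e set \<Rightarrow> ('e \<Rightarrow> 'x \<Rightarrow> real) set \<Rightarrow> bool" where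
  "fuzzy_soft_topology X E \<tau> \<longleftrightarrow>
     \<tau> \<subseteq> fuzzy_soft_sets X E \<and>
     fs_null X E \<in> \<tau> \<and> fs_universal X E \<in> \<tau> \<and>
     (\<forall>f\<in>\<tau>. \<forall>g\<in>\<tau>. fs_inter X E f g \<in> \<tau>) \<and>
     (\<forall>\<Psi>\<subseteq>\<tau>. fs_Union X E \<Psi> \<in> \<tau>)"

definition fs_mapping ::
  "'x set \<Rightarrow> 'e set \<Rightarrow> 'y set \<Rightarrow> 'k set \<Rightarrow> ('x \<Rightarrow> 'y) \<Rightarrow> ('e \<Rightarrow> 'k) \<Rightarrow> bool" where
  "fs_mapping X E Y K \<phi> \<psi> \<longleftrightarrow> \<phi> \<in> X \<rightarrow> Y \<and> \<psi> \<in> E \<rightarrow> K"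

definition fs_surjective ::
  "'x set \<Rightarrow> 'e set \<Rightarrow> 'y set \<Rightarrow> 'k set \<Rightarrow> ('x \<Rightarrow> 'y) \<Rightarrow> ('e \<Rightarrow> 'k) \<Rightarrow> bool" where
  "fs_surjective X E Y K \<phi> \<psi> \<longleftrightarrow> \<phi> ` X = Y \<and> \<psi> ` E = K"

definition fs_inverse_image ::
  "'x set \<Rightarrow> 'e set \<Rightarrow> ('x \<Rightarrow> 'y) \<Rightarrow> ('e \<Rightarrow> 'k) \<Rightarrow> ('k \<Rightarrow> 'y \<Rightarrow> real) \<Rightarrow> 'e \<Rightarrow> 'x \<Rightarrow> real" where
  "fs_inverse_image X E \<phi> \<psi> g = (\<lambda>e\<in>E. \<lambda>x\<in>X. g (\<psi> e) (\<phi> x))"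

definition fs_continuous ::
  "'x set \<Rightarrow> 'e set \<Rightarrow> ('e \<Rightarrow> 'x \<Rightarrow> real) set \<Rightarrow> ('k \<Rightarrow> 'y \<Rightarrow> real) set
    \<Rightarrow> ('x \<Rightarrow> 'y) \<Rightarrow> ('e \<Rightarrow> 'k) \<Rightarrow> bool" where
  "fs_continuous X E \<tau> \<sigma> \<phi> \<psi> \<longleftrightarrow> (\<forall>g\<in>\<sigma>. fs_inverse_image X E \<phi> \<psi> g \<in> \<tau>)"

definition fs_open_cover ::
  "'x set \<Rightarrow> 'e set \<Rightarrow> ('e \<Rightarrow> 'x \<Rightarrow> real) set \<Rightarrow> ('e \<Rightarrow> 'x \<Rightarrow> real) set \<Rightarrow> bool" where
  "fs_open_cover X E \<tau> \<Psi> \<longleftrightarrow>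
     \<Psi> \<subseteq> \<tau> \<and> fs_subset X E (fs_universal X E) (fs_Union X E \<Psi>)"

definition fs_compact :: "'x set \<Rightarrow> 'e set \<Rightarrow> ('e \<Rightarrow> 'x \<Rightarrow> real) set \<Rightarrow> bool" where
  "fs_compact X E \<tau> \<longleftrightarrow>
     (\<forall>\<Psi>. fs_open_cover X E \<tau> \<Psi> \<longrightarrow> (\<exists>\<Phi>\<subseteq>\<Psi>. finite \<Phi> \<and> fs_open_cover X E \<tau> \<Phi>))"

lemma fuzzy_soft_setsD:
  assumes "f \<in> fuzzy_soft_sets X E" "e \<in> E" "x \<in> X"
  shows "0 \<le> f e x" "f e x \<le> 1"
  using assms by (auto simp: fuzzy_soft_sets_def fuzzy_sets_def PiE_iff)

lemma fs_Union_in_fuzzy_soft_sets: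
  assumes "\<Psi> \<subseteq> fuzzy_soft_sets X E"
  shows "fs_Union X E \<Psi> \<in> fuzzy_soft_sets X E"
proof -
  have "Sup (insert 0 ((\<lambda>f. f e x) ` \<Psi>)) \<in> {0..1}" if "e \<in> E" "x \<in> X" for e x
  proof -
    have le: "y \<le> 1" if "y \<in> insert 0 ((\<lambda>f. f e x) ` \<Psi>)" for y
      using that assms \<open>e \<in> E\<close> \<open>x \<in> X\<close> by (auto intro: fuzzy_soft_setsD)
    have "0 \<le> Sup (insert 0 ((\<lambda>f. f e x) ` \<Psi>))"
      by (rule cSup_upper) (use le in \<open>auto intro!: bdd_aboveI\<close>)
    moreover have "Sup (insert 0 ((\<lambda>f. f e x) ` \<Psi>)) \<le> 1"
      by (rule cSup_least) (use le in auto)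
    ultimately show ?thesis by simp
  qed
  then show ?thesis
    by (simp add: fs_Union_def fuzzy_soft_sets_def fuzzy_sets_def)
qed

lemma fs_inverse_image_in_fuzzy_soft_sets:
  assumes "fs_mapping X E Y K \<phi> \<psi>" "g \<in> fuzzy_soft_sets Y K"
  shows "fs_inverse_image X E \<phi> \<psi> g \<in> fuzzy_soft_sets X E"
proof -
  have "g (\<psi> e) (\<phi> x) \<in> {0..1}" if "e \<in> E" "x \<in> X" for e x
    using that assms fuzzy_soft_setsD[OF assms(2), of "\<psi> e" "\<phi> x"]
    by (auto simp: fs_mapping_def)
  then show ?thesis
    by (simp add: fs_inverse_image_def fuzzy_soft_sets_def fuzzy_sets_def)
qed

end

theory Submission
  imports Defs
begin

lemma fs_Union_inverse_image:
  assumes "fs_mapping X E Y K \<phi> \<psi>"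
  shows "fs_Union X E (fs_inverse_image X E \<phi> \<psi> ` \<Psi>) =
    fs_inverse_image X E \<phi> \<psi> (fs_Union Y K \<Psi>)"
proof (intro ext)
  fix e x
  show "fs_Union X E (fs_inverse_image X E \<phi> \<psi> ` \<Psi>) e x =
    fs_inverse_image X E \<phi> \<psi> (fs_Union Y K \<Psi>) e x"
  proof (cases "e \<in> E \<and> x \<in> X")
    case True
    then have "\<psi> e \<in> K" "\<phi> x \<in> Y"
      using assms by (auto simp: fs_mapping_def)
    with True show ?thesis
      by (simp add: fs_Union_def fs_inverse_image_def image_image)
  qed (auto simp: fs_Union_def fs_inverse_image_def restrict_def)
qed

lemma fs_universal_subset_inverse_image_iff:
  assumes "fs_surjective X E Y K \<phi> \<psi>"
  shows "fs_subset X E (fs_universal X E) (fs_inverse_image X E \<phi> \<psi> g) \<longleftrightarrow>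
    fs_subset Y K (fs_universal Y K) g"
  using assms
  by (auto simp: fs_surjective_def fs_subset_def fs_universal_def fs_inverse_image_def)

lemma fs_open_cover_inverse_image_iff:
  assumes "fs_mapping X E Y K \<phi> \<psi>" "fs_continuous X E \<tau> \<sigma> \<phi> \<psi>"
    and "fs_surjective X E Y K \<phi> \<psi>" "\<Psi> \<subseteq> \<sigma>"
  shows "fs_open_cover X E \<tau> (fs_inverse_image X E \<phi> \<psi> ` \<Psi>) \<longleftrightarrow> fs_open_cover Y K \<sigma> \<Psi>"
proof -
  have "fs_inverse_image X E \<phi> \<psi> ` \<Psi> \<subseteq> \<tau>"
    using assms(2,4) by (auto simp: fs_continuous_def)
  then show ?thesis
    unfolding fs_open_cover_def fs_Union_inverse_image[OF assms(1)]
      fs_universal_subset_inverse_image_iff[OF assms(3)]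
    using assms(4) by simp
qed

theorem theorem3p8:
  fixes X :: "'x set" and E :: "'e set" and Y :: "'y set" and K :: "'k set"
    and \<tau> :: "('e \<Rightarrow> 'x \<Rightarrow> real) set" and \<sigma> :: "('k \<Rightarrow> 'y \<Rightarrow> real) set"
    and \<phi> :: "'x \<Rightarrow> 'y" and \<psi> :: "'e \<Rightarrow> 'k"
  assumes "X \<noteq> {}" and "Y \<noteq> {}"
    and "fuzzy_soft_topology X E \<tau>"
    and "fuzzy_soft_topology Y K \<sigma>"
    and "fs_mapping X E Y K \<phi> \<psi>"
    and "fs_continuous X E \<tau> \<sigma> \<phi> \<psi>"
    and "fs_surjective X E Y K \<phi> \<psi>"
    and "fs_compact X E \<tau>"
  shows "fs_compact Y K \<sigma>"
  unfolding fs_compact_def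
proof (intro allI impI)
  fix \<Psi>
  assume cover: "fs_open_cover Y K \<sigma> \<Psi>"
  then have "\<Psi> \<subseteq> \<sigma>"
    by (simp add: fs_open_cover_def)
  note iff = fs_open_cover_inverse_image_iff[OF assms(5-7)]
  have "fs_open_cover X E \<tau> (fs_inverse_image X E \<phi> \<psi> ` \<Psi>)"
    using cover iff[OF \<open>\<Psi> \<subseteq> \<sigma>\<close>] by simp
  with assms(8) obtain \<Theta> where \<Theta>: "\<Theta> \<subseteq> fs_inverse_image X E \<phi> \<psi> ` \<Psi>" "finite \<Theta>"
    "fs_open_cover X E \<tau> \<Theta>"
    unfolding fs_compact_def by blast
  then obtain \<Phi> where \<Phi>: "\<Phi> \<subseteq> \<Psi>" "finite \<Phi>" "\<Theta> = fs_inverse_image X E \<phi> \<psi> ` \<Phi>"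
    using finite_subset_image by metis
  moreover have "fs_open_cover Y K \<sigma> \<Phi>"
    using \<Theta>(3) \<Phi> iff[of \<Phi>] \<open>\<Psi> \<subseteq> \<sigma>\<close> by auto
  ultimately show "\<exists>\<Phi>\<subseteq>\<Psi>. finite \<Phi> \<and> fs_open_cover Y K \<sigma> \<Phi>"
    by blast
qed

end
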